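(* Let $G=(L,R,E)$ be a bipartite graph with edge weights $w:E\to\mathbb{R}_{\ge0}$ and let $p\in[0,1]$. Let $L'\subseteq L$ be a random subset such that each $u\in L$ is in $L'$ independently with probability $p$. Then $$\mathrm{E}\big[\mathrm{Greedy}(G[L'])\big]\ \ge\ \frac{p}{1+p}\cdot\mathrm{OPT}(G).$$ Moreover, there is a sequence of edge-weighted bipartite graphs $G_1,G_2,\dots$ on which $\mathrm{E}[\mathrm{Greedy}(G_k[L'])]/\mathrm{OPT}(G_k)$ approaches $p/(1+p)$ as $k\to\infty$.
   Context: Graphs are finite; ties between edge weights are broken by a fixed consistent rule, so edge weights are totally ordered. For $U\subseteq L$, $G[U]$ denotes the subgraph of $G$ induced on $U\cup R$ (the right side is always kept entirely). $\mathrm{Greedy}(H)$ is the weight of the matching obtained by processing the edges of $H$ in non-increasing order of weight, adding an edge iff neither endpoint is already covered. $\mathrm{OPT}(G)$ is the maximum weight of a matching in $G$. *)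

theory Defs
  imports "HOL-Probability.Probability"
begin

record ('l, 'r) weighted_bigraph =
  lefts :: "'l set"
  rights :: "'r set"
  edges :: "('l \<times> 'r) set"
  weight :: "'l \<times> 'r \<Rightarrow> real"

text \<open>The two sides live in separate types, hence are disjoint. Only the weights of actual
  edges matter.\<close>

definition weighted_bipartite :: "('l, 'r) weighted_bigraph \<Rightarrow> bool" where
  "weighted_bipartite G \<longleftrightarrow>
     finite (lefts G) \<and> finite (rights G) \<and> edges G \<subseteq> lefts G \<times> rights G \<and>
     (\<forall>e\<in>edges G. weight G e \<ge> 0)"

definition induced_left :: "('l, 'r) weighted_bigraph \<Rightarrow> 'l set \<Rightarrow> ('l, 'r) weighted_bigraph" where
  "induced_left G U = G\<lparr>lefts := lefts G \<inter> U, edges := {e \<in> edges G. fst e \<in> U}\<rparr>"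

definition is_matching :: "('l, 'r) weighted_bigraph \<Rightarrow> ('l \<times> 'r) set \<Rightarrow> bool" where
  "is_matching G M \<longleftrightarrow>
     M \<subseteq> edges G \<and> (\<forall>e\<in>M. \<forall>f\<in>M. e \<noteq> f \<longrightarrow> fst e \<noteq> fst f \<and> snd e \<noteq> snd f)"

definition opt :: "('l, 'r) weighted_bigraph \<Rightarrow> real" where
  "opt G = Max {(\<Sum>e\<in>M. weight G e) | M. is_matching G M}"

text \<open>A tie-breaking rule is a linear order on all potential edges, so that one and the same rule
  serves a graph and all its subgraphs; \<open>(e, f) \<in> tie\<close> means that \<open>e\<close> goes first.\<close>

definition precedes ::
    "('l \<times> 'r) rel \<Rightarrow> ('l, 'r) weighted_bigraph \<Rightarrow> 'l \<times> 'r \<Rightarrow> 'l \<times> 'r \<Rightarrow> bool" where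
  "precedes tie G e f \<longleftrightarrow>
     weight G e > weight G f \<or> (weight G e = weight G f \<and> (e, f) \<in> tie)"

definition greedy_order ::
    "('l \<times> 'r) rel \<Rightarrow> ('l, 'r) weighted_bigraph \<Rightarrow> ('l \<times> 'r) list" where
  "greedy_order tie G =
     (THE es. set es = edges G \<and> distinct es \<and> sorted_wrt (precedes tie G) es)"

definition greedy_step :: "'l \<times> 'r \<Rightarrow> ('l \<times> 'r) set \<Rightarrow> ('l \<times> 'r) set" where
  "greedy_step e M = (if fst e \<in> fst ` M \<or> snd e \<in> snd ` M then M else insert e M)"

definition greedy_matching ::
    "('l \<times> 'r) rel \<Rightarrow> ('l, 'r) weighted_bigraph \<Rightarrow> ('l \<times> 'r) set" where
  "greedy_matching tie G = fold greedy_step (greedy_order tie G) {}"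

definition greedy :: "('l \<times> 'r) rel \<Rightarrow> ('l, 'r) weighted_bigraph \<Rightarrow> real" where
  "greedy tie G = (\<Sum>e\<in>greedy_matching tie G. weight G e)"

definition random_subset :: "real \<Rightarrow> 'a set \<Rightarrow> 'a set pmf" where
  "random_subset p A = map_pmf (\<lambda>f. {x\<in>A. f x}) (Pi_pmf A False (\<lambda>_. bernoulli_pmf p))"

definition expected_greedy ::
    "real \<Rightarrow> ('l \<times> 'r) rel \<Rightarrow> ('l, 'r) weighted_bigraph \<Rightarrow> real" where
  "expected_greedy p tie G =
     measure_pmf.expectation (random_subset p (lefts G)) (\<lambda>U. greedy tie (induced_left G U))"

text \<open>The definite description in \<^const>\<open>greedy_order\<close> and the maximum in \<^const>\<open>opt\<close> are
  well defined.\<close>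

lemma ex_sorted_wrt_list:
  assumes "finite A"
    and total: "\<And>x y. x \<noteq> y \<Longrightarrow> P x y \<or> P y x"
    and trans: "\<And>x y z. P x y \<Longrightarrow> P y z \<Longrightarrow> P x z"
  shows "\<exists>xs. set xs = A \<and> distinct xs \<and> sorted_wrt P xs"
  using \<open>finite A\<close>
proof induction
  case (insert a A)
  then obtain xs where xs: "set xs = A" "distinct xs" "sorted_wrt P xs"
    by blast
  let ?ys = "filter (\<lambda>x. P x a) xs @ a # filter (\<lambda>x. \<not> P x a) xs"
  have later: "P a y" if "y \<in> A" "\<not> P y a" for y
    using total[of a y] that insert.hyps(2) by blast
  have "set ?ys = insert a A" "distinct ?ys"
    using xs insert.hyps(2) by auto
  moreover have "sorted_wrt P ?ys"
    using xs by (auto simp: sorted_wrt_append sorted_wrt_filter intro: later trans)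
  ultimately show ?case by blast
qed auto

lemma sorted_wrt_list_unique:
  assumes antisym: "\<And>x y. P x y \<Longrightarrow> P y x \<Longrightarrow> x = y"
    and "set xs = set ys" "distinct xs" "distinct ys" "sorted_wrt P xs" "sorted_wrt P ys"
  shows "xs = ys"
  using assms(2-)
proof (induction xs arbitrary: ys)
  case (Cons x xs)
  then obtain y ys' where ys: "ys = y # ys'"
    by (cases ys) auto
  have "x = y"
  proof (rule ccontr)
    assume "x \<noteq> y"
    then have "x \<in> set ys'" "y \<in> set xs"
      using Cons.prems(1) unfolding ys by auto
    then have "P y x" "P x y"
      using Cons.prems(4,5) unfolding ys by auto
    then show False
      using antisym \<open>x \<noteq> y\<close> by blast
  qed
  moreover have "xs = ys'"
    using Cons.prems \<open>x = y\<close> unfolding ys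
    by (intro Cons.IH) (auto dest: insert_ident[THEN iffD1, rotated 2])
  ultimately show ?case by (simp add: ys)
qed auto

lemma greedy_order_ex1:
  assumes "weighted_bipartite G" "linear_order_on UNIV tie"
  shows "\<exists>!es. set es = edges G \<and> distinct es \<and> sorted_wrt (precedes tie G) es"
proof -
  have tie: "trans tie" "antisym tie" "total tie"
    using assms(2) by (auto simp: order_on_defs)
  have fin: "finite (edges G)"
    using assms(1) unfolding weighted_bipartite_def by (meson finite_SigmaI finite_subset)
  have total: "precedes tie G x y \<or> precedes tie G y x" if "x \<noteq> y" for x y
    using tie(3) that unfolding precedes_def total_on_def by (metis UNIV_I linorder_neqE)
  have trans: "precedes tie G x z" if "precedes tie G x y" "precedes tie G y z" for x y z
    using that tie(1) unfolding precedes_def by (auto dest: transD)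
  have antisym: "x = y" if "precedes tie G x y" "precedes tie G y x" for x y
    using that tie(2) unfolding precedes_def by (auto dest: antisymD)
  show ?thesis
    using ex_sorted_wrt_list[of "edges G" "precedes tie G", OF fin total trans]
      sorted_wrt_list_unique[of "precedes tie G", OF antisym]
    by (intro ex_ex1I) auto
qed

lemma finite_matching_weights:
  assumes "weighted_bipartite G"
  shows "finite {(\<Sum>e\<in>M. weight G e) | M. is_matching G M}"
    and "{(\<Sum>e\<in>M. weight G e) | M. is_matching G M} \<noteq> {}"
proof -
  have "finite (edges G)"
    using assms unfolding weighted_bipartite_def by (meson finite_SigmaI finite_subset)
  then have "finite {M. is_matching G M}"
    by (rule finite_subset[rotated, OF finite_Pow_iff[THEN iffD2]]) (auto simp: is_matching_def)
  then show "finite {(\<Sum>e\<in>M. weight G e) | M. is_matching G M}"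
    by (simp add: setcompr_eq_image)
  have "is_matching G {}"
    by (simp add: is_matching_def)
  then show "{(\<Sum>e\<in>M. weight G e) | M. is_matching G M} \<noteq> {}"
    by blast
qed

end

theory Submission
  imports Defs
begin

text \<open>Decide membership in the random set lazily: scan all edges of \<open>G\<close> in greedy order and
  \<^emph>\<open>consider\<close> an edge when its left endpoint has not been considered before and its right endpoint
  is still free; only then toss the coin of the left endpoint, and match the edge if it comes up
  heads. The matched edges form the greedy matching of the induced subgraph. Whether an edge is
  considered does not depend on the coin of its own left endpoint, so the expected matched weight is
  \<open>p\<close> times the expected considered weight. Each edge of an optimal matching is dominated either by
  a considered edge at its left endpoint or by a matched edge at its right endpoint, so the optimum
  is at most the considered weight plus the matched weight, and taking expectations gives the bound.

  It is tight on the triangular graph \<open>{(i, j). i \<le> j < n}\<close> with weights close to \<open>1\<close>, increasing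
  in \<open>j\<close> and decreasing in \<open>i\<close>: there the numbers of considered and of matched edges always add up
  to at most \<open>n + 1\<close>.\<close>

section \<open>Lazy greedy scan and considered edges\<close>

text \<open>\<open>C\<close> collects the considered edges, whether heads or tails. \<open>U\<close>
  is consulted only at left endpoints of edges already in \<open>C\<close>, which models the lazy
  coin toss; an edge of \<open>C\<close> occupies its right endpoint only if its coin came up
  heads.\<close>

definition consider_step :: "'l set \<Rightarrow> 'l \<times> 'r \<Rightarrow> ('l \<times> 'r) set \<Rightarrow> ('l \<times> 'r) set" where
  "consider_step U e C =
     (if fst e \<in> fst ` C \<or> snd e \<in> snd ` {f \<in> C. fst f \<in> U} then C else insert e C)"

definition considered ::
    "('l \<times> 'r) rel \<Rightarrow> ('l, 'r) weighted_bigraph \<Rightarrow> 'l set \<Rightarrow> ('l \<times> 'r) set" where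
  "considered tie G U = fold (consider_step U) (greedy_order tie G) {}"

lemma greedy_order_props:
  assumes "weighted_bipartite G" "linear_order_on UNIV tie"
  shows "set (greedy_order tie G) = edges G" "distinct (greedy_order tie G)"
    "sorted_wrt (precedes tie G) (greedy_order tie G)"
  using theI'[OF greedy_order_ex1[OF assms]] unfolding greedy_order_def by auto

lemma weighted_bipartite_induced_left:
  "weighted_bipartite G \<Longrightarrow> weighted_bipartite (induced_left G U)"
  unfolding weighted_bipartite_def induced_left_def by auto

lemma finite_edges: "weighted_bipartite G \<Longrightarrow> finite (edges G)"
  unfolding weighted_bipartite_def by (meson finite_SigmaI finite_subset)

text \<open>Deleting left vertices changes no weight, so the filtered list is sorted for the same
  comparison, and uniqueness of the sorted list identifies it.\<close>

lemma greedy_order_induced_left: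
  assumes "weighted_bipartite G" "linear_order_on UNIV tie"
  shows "greedy_order tie (induced_left G U) = filter (\<lambda>e. fst e \<in> U) (greedy_order tie G)"
proof -
  have "precedes tie (induced_left G U) = precedes tie G"
    by (auto simp: precedes_def induced_left_def fun_eq_iff)
  then have "set (filter (\<lambda>e. fst e \<in> U) (greedy_order tie G)) = edges (induced_left G U) \<and>
      distinct (filter (\<lambda>e. fst e \<in> U) (greedy_order tie G)) \<and>
      sorted_wrt (precedes tie (induced_left G U)) (filter (\<lambda>e. fst e \<in> U) (greedy_order tie G))"
    using greedy_order_props[OF assms] by (auto simp: induced_left_def sorted_wrt_filter)
  with greedy_order_ex1[OF weighted_bipartite_induced_left[OF assms(1)] assms(2), of U]
  show ?thesis
    unfolding greedy_order_def[of tie "induced_left G U"] by (rule the1_equality)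
qed

text \<open>The invariant is that \<open>M\<close> is the heads part of \<open>C\<close>. A tails
  edge may enter \<open>C\<close> but not \<open>M\<close>; for a heads edge both scans make the
  same test, since any edge of \<open>C\<close> at a left endpoint in \<open>U\<close> already lies
  in \<open>M\<close>.\<close>

lemma fold_greedy_step_filter:
  "M = {f \<in> C. fst f \<in> U} \<Longrightarrow>
   fold greedy_step (filter (\<lambda>e. fst e \<in> U) es) M = {f \<in> fold (consider_step U) es C. fst f \<in> U}"
proof (induction es arbitrary: C M)
  case (Cons e es)
  show ?case
  proof (cases "fst e \<in> U")
    case True
    then have "fst e \<in> fst ` C \<longleftrightarrow> fst e \<in> fst ` M"
      using Cons.prems by force
    then have "greedy_step e M = {f \<in> consider_step U e C. fst f \<in> U}"
      using Cons.prems True by (auto simp: greedy_step_def consider_step_def)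
    then show ?thesis
      using True by (simp add: Cons.IH)
  next
    case False
    then have "M = {f \<in> consider_step U e C. fst f \<in> U}"
      using Cons.prems by (auto simp: consider_step_def)
    then show ?thesis
      using False by (simp add: Cons.IH)
  qed
qed auto

lemma greedy_matching_induced_left:
  assumes "weighted_bipartite G" "linear_order_on UNIV tie"
  shows "greedy_matching tie (induced_left G U) = {f \<in> considered tie G U. fst f \<in> U}"
  unfolding greedy_matching_def greedy_order_induced_left[OF assms] considered_def
  by (rule fold_greedy_step_filter) auto

lemma fold_consider_step_mono: "C \<subseteq> fold (consider_step U) es C"
proof (induction es arbitrary: C)
  case (Cons e es)
  have "C \<subseteq> consider_step U e C" by (auto simp: consider_step_def)
  with Cons[of "consider_step U e C"] show ?case by auto
qed auto

lemma fold_consider_step_subset: "fold (consider_step U) es C \<subseteq> C \<union> set es"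
proof (induction es arbitrary: C)
  case (Cons e es)
  have "consider_step U e C \<subseteq> insert e C" by (auto simp: consider_step_def)
  with Cons[of "consider_step U e C"] show ?case by auto
qed auto

lemma considered_subset:
  assumes "weighted_bipartite G" "linear_order_on UNIV tie"
  shows "considered tie G U \<subseteq> edges G"
  using fold_consider_step_subset[of U "greedy_order tie G" "{}"] greedy_order_props[OF assms]
  by (auto simp: considered_def)

text \<open>This trades the fold for a recursive characterization, used in the combinatorial
  arguments below. The considered edges preceding \<open>e\<close> are exactly the state of the scan
  when \<open>e\<close> is reached, because from then on only \<open>e\<close> and edges after it
  can be added.\<close>

lemma in_considered_iff:
  assumes G: "weighted_bipartite G" "linear_order_on UNIV tie" and e: "e \<in> edges G"
  shows "e \<in> considered tie G U \<longleftrightarrow>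
    \<not> (\<exists>f\<in>considered tie G U. f \<noteq> e \<and> precedes tie G f e \<and>
         (fst f = fst e \<or> fst f \<in> U \<and> snd f = snd e))"
proof -
  note props = greedy_order_props[OF G]
  have antisym: "x = y" if "precedes tie G x y" "precedes tie G y x" for x y
    using that G(2) unfolding precedes_def by (auto simp: order_on_defs dest: antisymD)
  obtain xs ys where es: "greedy_order tie G = xs @ e # ys"
    using e props(1) by (metis split_list)
  define C where "C = fold (consider_step U) xs {}"
  define D where "D = considered tie G U"
  have D: "D = fold (consider_step U) ys (consider_step U e C)"
    by (simp add: D_def C_def considered_def es)
  have C_xs: "C \<subseteq> set xs"
    using fold_consider_step_subset[of U xs "{}"] by (auto simp: C_def)
  have e_nin: "e \<notin> set xs" "e \<notin> set ys"
    using props(2) es by auto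
  have step: "consider_step U e C \<subseteq> D" "D \<subseteq> consider_step U e C \<union> set ys"
    unfolding D by (rule fold_consider_step_mono fold_consider_step_subset)+
  have C_sub: "C \<subseteq> consider_step U e C" "consider_step U e C \<subseteq> insert e C"
    by (auto simp: consider_step_def)
  have before: "{f \<in> D. f \<noteq> e \<and> precedes tie G f e} = C"
  proof (intro equalityI subsetI)
    fix f assume f: "f \<in> {f \<in> D. f \<noteq> e \<and> precedes tie G f e}"
    have "f \<notin> set ys"
      using f antisym[of e f] props(3) unfolding es by (auto simp: sorted_wrt_append)
    then show "f \<in> C" using f step(2) C_sub(2) by auto
  next
    fix f assume "f \<in> C"
    then show "f \<in> {f \<in> D. f \<noteq> e \<and> precedes tie G f e}"
      using C_xs e_nin step(1) C_sub(1) props(3) unfolding es by (auto simp: sorted_wrt_append)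
  qed
  have "e \<in> D \<longleftrightarrow> e \<in> consider_step U e C"
    using step e_nin by auto
  also have "\<dots> \<longleftrightarrow> \<not> (\<exists>f\<in>C. fst f = fst e \<or> fst f \<in> U \<and> snd f = snd e)"
    using C_xs e_nin unfolding consider_step_def by (auto simp: image_iff)
  also have "\<dots> \<longleftrightarrow> \<not> (\<exists>f\<in>D. f \<noteq> e \<and> precedes tie G f e \<and>
      (fst f = fst e \<or> fst f \<in> U \<and> snd f = snd e))"
    using before by blast
  finally show ?thesis unfolding D_def .
qed

text \<open>Of two edges violating the claim, the later one would have been blocked by the earlier
  one.\<close>

lemma considered_disjoint:
  assumes G: "weighted_bipartite G" "linear_order_on UNIV tie"
    and "e \<in> considered tie G U" "f \<in> considered tie G U" "e \<noteq> f"
  shows "fst e \<noteq> fst f" "fst e \<in> U \<Longrightarrow> fst f \<in> U \<Longrightarrow> snd e \<noteq> snd f"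
proof -
  have "precedes tie G e f \<or> precedes tie G f e"
    using assms(2,5) unfolding precedes_def order_on_defs total_on_def
    by (metis UNIV_I linorder_neqE)
  moreover have "e \<in> edges G" "f \<in> edges G"
    using assms considered_subset[OF G] by auto
  ultimately show "fst e \<noteq> fst f" "fst e \<in> U \<Longrightarrow> fst f \<in> U \<Longrightarrow> snd e \<noteq> snd f"
    using assms(3-5) in_considered_iff[OF G] by metis+
qed

text \<open>The two runs coincide until an edge at the left endpoint of \<open>e\<close> is considered; after that
  neither run considers another edge there.\<close>

lemma considered_insert_iff:
  "e \<in> considered tie G (insert (fst e) U) \<longleftrightarrow> e \<in> considered tie G U"
proof -
  define u where "u = fst e"
  have "{f \<in> fold (consider_step (insert u U)) es C. fst f = u} =
      {f \<in> fold (consider_step U) es D. fst f = u}"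
    if "C = D \<and> u \<notin> fst ` D \<or>
      {f \<in> C. fst f = u} = {f \<in> D. fst f = u} \<and> u \<in> fst ` D" for es C D
    using that
  proof (induction es arbitrary: C D)
    case (Cons a es)
    let ?C = "consider_step (insert u U) a C" and ?D = "consider_step U a D"
    have "?C = ?D \<and> u \<notin> fst ` ?D \<or>
      {f \<in> ?C. fst f = u} = {f \<in> ?D. fst f = u} \<and> u \<in> fst ` ?D"
      using Cons.prems
    proof
      assume *: "C = D \<and> u \<notin> fst ` D"
      \<comment> \<open>No edge at \<open>u\<close> has been considered yet, so the coin of
        \<open>u\<close> has not been read.\<close>
      then have "{f \<in> D. fst f \<in> insert u U} = {f \<in> D. fst f \<in> U}" by auto
      then have "?C = ?D" using * by (simp add: consider_step_def)
      then show ?thesis by auto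
    next
      assume *: "{f \<in> C. fst f = u} = {f \<in> D. fst f = u} \<and> u \<in> fst ` D"
      then have "u \<in> fst ` C" by force
      then have "{f \<in> ?C. fst f = u} = {f \<in> C. fst f = u}"
        "{f \<in> ?D. fst f = u} = {f \<in> D. fst f = u}"
        using * by (auto simp: consider_step_def)
      moreover have "u \<in> fst ` ?D" using * by (auto simp: consider_step_def)
      ultimately show ?thesis using * by simp
    qed
    then show ?case using Cons.IH by simp
  qed auto
  from this[of "{}" "{}" "greedy_order tie G"] show ?thesis
    unfolding considered_def u_def by auto
qed

section \<open>The optimum against considered and matched weight\<close>

lemma opt_attained:
  assumes "weighted_bipartite G"
  obtains M where "is_matching G M" "opt G = (\<Sum>e\<in>M. weight G e)"
  using Max_in[OF finite_matching_weights[OF assms]] unfolding opt_def by auto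

lemma matching_weight_le_opt:
  assumes "weighted_bipartite G" "is_matching G M"
  shows "(\<Sum>e\<in>M. weight G e) \<le> opt G"
  unfolding opt_def using assms by (intro Max_ge finite_matching_weights) auto

text \<open>A charging argument: each element of \<open>A\<close> is charged to a witness in
  \<open>B\<close> with the same key, and injectivity of \<open>key\<close> on \<open>A\<close>
  keeps the witnesses distinct.\<close>

lemma sum_le_sum_injective_witness:
  fixes w :: "'a \<Rightarrow> real"
  assumes "finite B" "\<And>b. b \<in> B \<Longrightarrow> 0 \<le> w b"
    and "\<And>a. a \<in> A \<Longrightarrow> \<exists>b\<in>B. key b = key a \<and> w a \<le> w b" and "inj_on key A"
  shows "sum w A \<le> sum w B"
proof -
  obtain g where g: "\<And>a. a \<in> A \<Longrightarrow> g a \<in> B \<and> key (g a) = key a \<and> w a \<le> w (g a)"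
    using assms(3) by metis
  have "inj_on g A"
    using g assms(4) by (metis inj_on_def)
  have "sum w A \<le> (\<Sum>a\<in>A. w (g a))"
    using g by (intro sum_mono) auto
  also have "\<dots> = sum w (g ` A)"
    using \<open>inj_on g A\<close> by (simp add: sum.reindex)
  also have "\<dots> \<le> sum w B"
    using g assms(1,2) by (intro sum_mono2) auto
  finally show ?thesis .
qed

lemma opt_le_considered:
  assumes G: "weighted_bipartite G" "linear_order_on UNIV tie"
  shows "opt G \<le> (\<Sum>e\<in>considered tie G U. weight G e) +
    (\<Sum>e\<in>{f \<in> considered tie G U. fst f \<in> U}. weight G e)"
proof -
  define C where "C = considered tie G U"
  have C: "C \<subseteq> edges G" "finite C"
    using considered_subset[OF G] finite_edges[OF G(1)] finite_subset unfolding C_def by blast+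
  have nonneg: "0 \<le> weight G e" if "e \<in> C" for e
    using that C G(1) unfolding weighted_bipartite_def by auto
  obtain M where M: "is_matching G M" "opt G = (\<Sum>e\<in>M. weight G e)"
    using opt_attained[OF G(1)] .
  have inj: "inj_on fst M" "inj_on snd M"
    using M(1) unfolding is_matching_def inj_on_def by blast+
  have "finite M"
    using M(1) finite_edges[OF G(1)] unfolding is_matching_def by (metis finite_subset)
  \<comment> \<open>\<open>M1\<close> holds the optimal edges charged at their left endpoint, among
    them every considered one, as its own witness. The rest are charged to matched edges at their
    right endpoint.\<close>
  define M1 where "M1 = {e \<in> M. \<exists>f\<in>C. fst f = fst e \<and> weight G e \<le> weight G f}"
  have "(\<Sum>e\<in>M1. weight G e) \<le> (\<Sum>e\<in>C. weight G e)"
    using C nonneg inj by (intro sum_le_sum_injective_witness[where key = fst])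
      (auto simp: M1_def intro: inj_on_subset)
  moreover have "(\<Sum>e\<in>M - M1. weight G e) \<le> (\<Sum>e\<in>{f \<in> C. fst f \<in> U}. weight G e)"
  proof (rule sum_le_sum_injective_witness[where key = snd])
    fix e assume e: "e \<in> M - M1"
    then have "e \<notin> C" "e \<in> edges G"
      using M(1) by (auto simp: M1_def is_matching_def)
    \<comment> \<open>The blocking edge \<open>f\<close> is at least as heavy as \<open>e\<close>;
      if it shared the left endpoint, \<open>e\<close> would be in \<open>M1\<close>.\<close>
    then obtain f where f: "f \<in> C" "precedes tie G f e" "fst f = fst e \<or> fst f \<in> U \<and> snd f = snd e"
      using in_considered_iff[OF G, of e U] unfolding C_def by blast
    then have "weight G e \<le> weight G f"
      by (auto simp: precedes_def)
    with f e show "\<exists>f\<in>{f \<in> C. fst f \<in> U}. snd f = snd e \<and> weight G e \<le> weight G f"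
      by (intro bexI[of _ f]) (auto simp: M1_def)
  qed (use C nonneg inj in \<open>auto intro: inj_on_subset\<close>)
  moreover have "(\<Sum>e\<in>M. weight G e) = (\<Sum>e\<in>M1. weight G e) + (\<Sum>e\<in>M - M1. weight G e)"
    using \<open>finite M\<close> sum.subset_diff[of M1 M "weight G"] by (simp add: M1_def add.commute)
  ultimately show ?thesis
    using M(2) unfolding C_def by linarith
qed

section \<open>Expectations over the random subset\<close>

lemma set_pmf_random_subset: "set_pmf (random_subset p A) \<subseteq> Pow A"
  by (auto simp: random_subset_def)

lemma integrable_random_subset:
  fixes F :: "'a set \<Rightarrow> real"
  assumes "finite A"
  shows "integrable (measure_pmf (random_subset p A)) F"
  using assms set_pmf_random_subset[of p A]
  by (intro integrable_measure_pmf_finite) (meson finite_Pow_iff finite_subset)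

lemma expectation_random_subset_insert:
  fixes F :: "'a set \<Rightarrow> real"
  assumes "finite A" "u \<notin> A" "0 \<le> p" "p \<le> 1"
  shows "measure_pmf.expectation (random_subset p (insert u A)) F =
    p * measure_pmf.expectation (random_subset p A) (\<lambda>U. F (insert u U)) +
    (1 - p) * measure_pmf.expectation (random_subset p A) F"
proof -
  have *: "{x \<in> insert u A. (f(u := b)) x} = (if b then insert u else id) {x \<in> A. f x}" for f b
    using assms(2) by auto
  have "random_subset p (insert u A) =
      bernoulli_pmf p \<bind> (\<lambda>b. map_pmf (if b then insert u else id) (random_subset p A))"
    unfolding random_subset_def Pi_pmf_insert'[OF assms(1,2)]
    by (simp add: map_pmf_def bind_assoc_pmf bind_return_pmf * del: fun_upd_apply insert_iff)
  moreover have "finite (set_pmf (random_subset p A))"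
    using assms(1) set_pmf_random_subset by (metis finite_Pow_iff finite_subset)
  then have "measure_pmf.expectation
      (bernoulli_pmf p \<bind> (\<lambda>b. map_pmf (if b then insert u else id) (random_subset p A))) F =
    (\<Sum>b\<in>UNIV. pmf (bernoulli_pmf p) b *\<^sub>R measure_pmf.expectation
      (map_pmf (if b then insert u else id) (random_subset p A)) F)"
    by (intro pmf_expectation_bind) auto
  ultimately show ?thesis
    using assms(3,4) by (simp add: UNIV_bool)
qed

text \<open>The hypothesis on \<open>F\<close> says that \<open>F\<close> ignores the coin of
  \<open>u\<close>, so conditioning on this coin splits off the factor \<open>p\<close>.\<close>

lemma expectation_random_subset_member:
  fixes F :: "'a set \<Rightarrow> real"
  assumes "finite A" "u \<in> A" "0 \<le> p" "p \<le> 1" and F: "\<And>U. F (insert u U) = F U"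
  shows "measure_pmf.expectation (random_subset p A) (\<lambda>U. if u \<in> U then F U else 0) =
    p * measure_pmf.expectation (random_subset p A) F"
proof -
  define B where "B = A - {u}"
  have B: "A = insert u B" "u \<notin> B" "finite B"
    using assms by (auto simp: B_def)
  \<comment> \<open>This is the tails case: a subset drawn from \<open>B\<close> never contains
    \<open>u\<close>.\<close>
  have "measure_pmf.expectation (random_subset p B) (\<lambda>U. if u \<in> U then F U else 0) =
      measure_pmf.expectation (random_subset p B) (\<lambda>U. 0)"
    using B(2) set_pmf_random_subset[of p B] by (intro integral_cong_AE) (auto simp: AE_measure_pmf_iff)
  then show ?thesis
    unfolding B(1) using B(2,3) assms(3,4)
    by (simp add: expectation_random_subset_insert F algebra_simps)
qed

text \<open>Linearity reduces this to a single edge \<open>e\<close>, where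
  \<open>considered_insert_iff\<close> makes being considered independent of the coin of
  \<open>fst e\<close>. The function \<open>h\<close> is general because it is the weight in the
  lower bound and constantly 1 in the tightness proof.\<close>

lemma expectation_considered:
  fixes h :: "'l \<times> 'r \<Rightarrow> real"
  assumes G: "weighted_bipartite G" "linear_order_on UNIV tie" and p: "0 \<le> p" "p \<le> 1"
  shows "measure_pmf.expectation (random_subset p (lefts G))
      (\<lambda>U. \<Sum>e\<in>{f \<in> considered tie G U. fst f \<in> U}. h e) =
    p * measure_pmf.expectation (random_subset p (lefts G)) (\<lambda>U. \<Sum>e\<in>considered tie G U. h e)"
proof -
  let ?E = "measure_pmf.expectation (random_subset p (lefts G))"
  let ?R = "\<lambda>U. \<Sum>e\<in>considered tie G U. h e"
  let ?L = "\<lambda>U. \<Sum>e\<in>{f \<in> considered tie G U. fst f \<in> U}. h e"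
  let ?C = "considered tie G"
  have fin: "finite (lefts G)" and lefts: "\<And>e. e \<in> edges G \<Longrightarrow> fst e \<in> lefts G"
    using G(1) by (auto simp: weighted_bipartite_def)
  note sub = considered_subset[OF G] and finE = finite_edges[OF G(1)]
  \<comment> \<open>Both sums are spread over the fixed set \<open>edges G\<close>, so that
    expectation and sum can be exchanged.\<close>
  have L: "?L U = (\<Sum>e\<in>edges G. if fst e \<in> U then if e \<in> ?C U then h e else 0 else 0)" for U
    using sub[of U] finE by (intro sum.mono_neutral_cong_left) auto
  have R: "?R U = (\<Sum>e\<in>edges G. if e \<in> ?C U then h e else 0)" for U
    using sub[of U] finE by (intro sum.mono_neutral_cong_left) auto
  have "?E ?L = (\<Sum>e\<in>edges G. ?E (\<lambda>U. if fst e \<in> U then if e \<in> ?C U then h e else 0 else 0))"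
    unfolding L by (rule Bochner_Integration.integral_sum) (rule integrable_random_subset[OF fin])
  also have "\<dots> = (\<Sum>e\<in>edges G. p * ?E (\<lambda>U. if e \<in> ?C U then h e else 0))"
    using fin lefts p
    by (intro sum.cong expectation_random_subset_member) (auto simp: considered_insert_iff)
  also have "\<dots> = p * ?E ?R"
    unfolding R sum_distrib_left[symmetric]
    by (subst Bochner_Integration.integral_sum) (auto intro: integrable_random_subset[OF fin])
  finally show ?thesis .
qed

lemma expected_greedy_eq:
  assumes G: "weighted_bipartite G" "linear_order_on UNIV tie"
  shows "expected_greedy p tie G = measure_pmf.expectation (random_subset p (lefts G))
      (\<lambda>U. \<Sum>e\<in>{f \<in> considered tie G U. fst f \<in> U}. weight G e)"
  unfolding expected_greedy_def greedy_def greedy_matching_induced_left[OF G]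
  by (simp add: induced_left_def)

lemma expected_greedy_ge:
  assumes G: "weighted_bipartite G" "linear_order_on UNIV tie" and p: "0 \<le> p" "p \<le> 1"
  shows "p / (1 + p) * opt G \<le> expected_greedy p tie G"
proof -
  let ?E = "measure_pmf.expectation (random_subset p (lefts G))"
  let ?R = "\<lambda>U. \<Sum>e\<in>considered tie G U. weight G e"
  let ?L = "\<lambda>U. \<Sum>e\<in>{f \<in> considered tie G U. fst f \<in> U}. weight G e"
  have fin: "finite (lefts G)"
    using G(1) by (auto simp: weighted_bipartite_def)
  note int = integrable_random_subset[OF fin, of p]
  have "opt G = ?E (\<lambda>U. opt G)" by simp
  also have "\<dots> \<le> ?E (\<lambda>U. ?R U + ?L U)"
    by (intro integral_mono int opt_le_considered G)
  also have "\<dots> = ?E ?R + ?E ?L"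
    by (intro Bochner_Integration.integral_add int)
  \<comment> \<open>Multiplying by \<open>p\<close> turns \<open>p * ?E ?R\<close> into the expected
    greedy weight without dividing by \<open>p\<close>, which may be 0.\<close>
  finally have "p * opt G \<le> p * ?E ?R + p * ?E ?L"
    using p(1) by (simp add: mult_left_mono flip: distrib_left)
  also have "\<dots> = (1 + p) * expected_greedy p tie G"
    by (simp add: expected_greedy_eq[OF G] expectation_considered[OF G p] algebra_simps)
  finally show ?thesis
    using p(1) by (simp add: field_simps)
qed

section \<open>Tightness on the triangular graph\<close>

text \<open>The perturbation makes distinct edges sharing an endpoint differ in weight. On edges it
  is at most 1/n, and it vanishes on the diagonal, a perfect matching of weight n.\<close>

definition triangle_graph :: "nat \<Rightarrow> (nat, nat) weighted_bigraph" where
  "triangle_graph n = \<lparr>lefts = {..<n}, rights = {..<n}, edges = {(i, j). i \<le> j \<and> j < n},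
     weight = (\<lambda>(i, j). 1 + (real j - real i) / (real n)\<^sup>2)\<rparr>"

lemma weighted_bipartite_triangle_graph: "weighted_bipartite (triangle_graph n)"
  by (auto simp: weighted_bipartite_def triangle_graph_def)

lemma opt_triangle_graph_ge: "real n \<le> opt (triangle_graph n)"
proof -
  let ?M = "(\<lambda>i. (i, i)) ` {..<n}"
  have "is_matching (triangle_graph n) ?M"
    by (auto simp: is_matching_def triangle_graph_def)
  moreover have "(\<Sum>e\<in>?M. weight (triangle_graph n) e) = real n"
    by (subst sum.reindex) (auto simp: inj_on_def triangle_graph_def)
  ultimately show ?thesis
    using matching_weight_le_opt[OF weighted_bipartite_triangle_graph] by metis
qed

lemma weight_triangle_graph_le:
  assumes "e \<in> edges (triangle_graph n)"
  shows "weight (triangle_graph n) e \<le> 1 + 1 / real n"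
proof -
  obtain i j where e: "e = (i, j)" "i \<le> j" "j < n"
    using assms by (auto simp: triangle_graph_def)
  then have "(real j - real i) / (real n)\<^sup>2 \<le> real n / (real n)\<^sup>2"
    by (intro divide_right_mono) auto
  then show ?thesis
    using e by (simp add: triangle_graph_def power2_eq_square)
qed

text \<open>Let (i, j) be the considered edge with the largest left endpoint. Considered edges have
  distinct left endpoints, all at most i, so there are at most i + 1. Matched edges other than (i,
  j) have distinct right endpoints beyond j, hence beyond i, so there are at most n - i - 1. One
  more for (i, j) itself gives n + 1.\<close>

lemma card_considered_triangle_graph:
  assumes tie: "linear_order_on UNIV tie"
  shows "card (considered tie (triangle_graph n) U) +
    card {f \<in> considered tie (triangle_graph n) U. fst f \<in> U} \<le> n + 1"
proof -
  let ?G = "triangle_graph n"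
  define C where "C = considered tie ?G U"
  define M where "M = {f \<in> C. fst f \<in> U}"
  note G = weighted_bipartite_triangle_graph[of n] tie
  have C: "C \<subseteq> edges ?G" "finite C"
    using considered_subset[OF G] finite_edges[OF G(1)] finite_subset unfolding C_def by blast+
  have injC: "inj_on fst C" and injM: "inj_on snd M"
    using considered_disjoint[OF G] unfolding C_def M_def inj_on_def by blast+
  have earlier: "precedes tie ?G (a, b) (c, d)" if "a \<le> c" "d \<le> b" "(a, b) \<noteq> (c, d)" "c \<le> d" "b < n"
    for a b c d
    using that by (auto simp: precedes_def triangle_graph_def divide_less_cancel)
  show ?thesis
  proof (cases "C = {}")
    case True
    then show ?thesis using C_def by auto
  next
    case False
    define i where "i = Max (fst ` C)"
    have "i \<in> fst ` C"
      unfolding i_def using False C by (intro Max_in) auto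
    then obtain j where ij: "(i, j) \<in> C" by force
    then have "i \<le> j" "j < n" using C by (auto simp: triangle_graph_def)
    have le: "fst f \<le> i" if "f \<in> C" for f
      unfolding i_def using that C by auto
    have "card C = card (fst ` C)" using injC by (simp add: card_image)
    also have "\<dots> \<le> card {..i}" using le by (intro card_mono) auto
    finally have card_C: "card C \<le> i + 1" by simp
    \<comment> \<open>Otherwise \<open>(i', j)\<close> is an edge preceding \<open>(i, j)\<close>,
      and either it or the edge blocking it would occupy \<open>j\<close> before
      \<open>(i, j)\<close> is reached.\<close>
    have "j < j'" if f: "(i', j') \<in> M" "(i', j') \<noteq> (i, j)" for i' j'
    proof -
      have f': "(i', j') \<in> C" "i' \<in> U" using f by (auto simp: M_def)
      then have "i' \<le> j'" "j' < n" using C by (auto simp: triangle_graph_def)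
      have "i' \<noteq> i" using injC f(2) f'(1) ij by (force simp: inj_on_def)
      then have "i' < i" using le[OF f'(1)] by simp
      show ?thesis
      proof (rule ccontr)
        assume "\<not> j < j'"
        then have "j' \<le> j" by simp
        have pre: "precedes tie ?G (i', j) (i, j)"
          using \<open>i' < i\<close> \<open>i \<le> j\<close> \<open>j < n\<close> by (intro earlier) auto
        have "j' \<noteq> j"
          using in_considered_iff[OF G, of "(i, j)" U] ij C f' pre \<open>i' \<noteq> i\<close>
          unfolding C_def by force
        have "(i', j) \<notin> C"
          using injC f'(1) \<open>j' \<noteq> j\<close> by (force simp: inj_on_def)
        moreover have edge: "(i', j) \<in> edges ?G"
          using \<open>i' < i\<close> \<open>i \<le> j\<close> \<open>j < n\<close> by (auto simp: triangle_graph_def)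
        ultimately obtain g where g: "g \<in> C" "g \<noteq> (i', j)" "precedes tie ?G g (i', j)"
          "fst g = i' \<or> fst g \<in> U \<and> snd g = j"
          using in_considered_iff[OF G, of "(i', j)" U] unfolding C_def by auto
        have weights: "weight ?G (i', j') < weight ?G (i', j)" "weight ?G (i, j) < weight ?G (i', j)"
          using \<open>j' \<le> j\<close> \<open>j' \<noteq> j\<close> \<open>i' < i\<close> \<open>j < n\<close>
          by (auto simp: triangle_graph_def divide_less_cancel)
        \<comment> \<open>The only considered edge at \<open>i'\<close> is \<open>(i', j')\<close>,
          which is lighter than \<open>(i', j)\<close>. So \<open>g\<close> is a matched edge at
          \<open>j\<close> heavier than \<open>(i, j)\<close>, which it blocks.\<close>
        have "fst g \<noteq> i'"
          using injC f'(1) g(1,3) weights(1) by (force simp: inj_on_def precedes_def)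
        then have "fst g \<in> U" "snd g = j" using g(4) by auto
        moreover have "weight ?G (i, j) < weight ?G g"
          using g(3) weights(2) by (auto simp: precedes_def)
        ultimately show False
          using in_considered_iff[OF G, of "(i, j)" U] ij C g(1)
          unfolding C_def precedes_def by force
      qed
    qed
    then have "snd ` (M - {(i, j)}) \<subseteq> {i<..<n}"
      using \<open>i \<le> j\<close> C unfolding M_def by (fastforce simp: triangle_graph_def)
    then have "card (snd ` (M - {(i, j)})) \<le> card {i<..<n}"
      by (intro card_mono) auto
    moreover have "card (snd ` (M - {(i, j)})) = card (M - {(i, j)})"
      using injM by (intro card_image) (auto intro: inj_on_subset)
    moreover have "card M \<le> card (M - {(i, j)}) + 1"
      by (auto simp: card_Diff_singleton_if)
    ultimately show ?thesis
      using card_C \<open>i \<le> j\<close> \<open>j < n\<close> unfolding C_def[symmetric] M_def[symmetric] by simp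
  qed
qed

text \<open>With \<open>h\<close> constantly 1, the cardinality bound limits the expected number of
  matched edges to p / (1 + p) * (n + 1); each weighs at most 1 + 1 / n.\<close>

lemma expected_greedy_triangle_graph_le:
  assumes tie: "linear_order_on UNIV tie" and p: "0 \<le> p" "p \<le> 1"
  shows "expected_greedy p tie (triangle_graph n) \<le> (1 + 1 / real n) * (p / (1 + p) * (real n + 1))"
proof -
  let ?G = "triangle_graph n"
  let ?E = "measure_pmf.expectation (random_subset p (lefts ?G))"
  let ?R = "\<lambda>U. \<Sum>e\<in>considered tie ?G U. 1 :: real"
  let ?L = "\<lambda>U. \<Sum>e\<in>{f \<in> considered tie ?G U. fst f \<in> U}. 1 :: real"
  note G = weighted_bipartite_triangle_graph[of n] tie
  have fin: "finite (lefts ?G)"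
    using G(1) by (auto simp: weighted_bipartite_def)
  note int = integrable_random_subset[OF fin, of p]
  have "?E ?R + ?E ?L = ?E (\<lambda>U. ?R U + ?L U)"
    by (intro Bochner_Integration.integral_add[symmetric] int)
  also have "\<dots> \<le> ?E (\<lambda>U. real n + 1)"
  proof (intro integral_mono int)
    fix U
    show "?R U + ?L U \<le> real n + 1"
      using card_considered_triangle_graph[OF tie, of n U] by simp
  qed
  finally have "p * ?E ?R + p * ?E ?L \<le> p * (real n + 1)"
    using p(1) by (simp add: mult_left_mono flip: distrib_left)
  then have "(1 + p) * ?E ?L \<le> p * (real n + 1)"
    by (simp only: expectation_considered[OF G p] algebra_simps)
  then have L: "?E ?L \<le> p / (1 + p) * (real n + 1)"
    using p(1) by (simp add: field_simps)
  have "expected_greedy p tie ?G \<le> ?E (\<lambda>U. (1 + 1 / real n) * ?L U)"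
    unfolding expected_greedy_eq[OF G] sum_distrib_left
    using considered_subset[OF G]
    by (intro integral_mono int sum_mono) (auto intro!: weight_triangle_graph_le)
  also have "\<dots> = (1 + 1 / real n) * ?E ?L" by simp
  also have "\<dots> \<le> (1 + 1 / real n) * (p / (1 + p) * (real n + 1))"
    using L by (intro mult_left_mono) auto
  finally show ?thesis .
qed

text \<open>The general lower bound and the estimate for triangular graphs, divided by an optimum of
  at least n, squeeze the ratio. The index \<open>Suc k\<close> avoids the edgeless graph, whose
  optimum is 0.\<close>

lemma triangle_graph_ratio_tendsto:
  assumes tie: "linear_order_on UNIV tie" and p: "0 \<le> p" "p \<le> 1"
  shows "(\<lambda>k. expected_greedy p tie (triangle_graph (Suc k)) / opt (triangle_graph (Suc k)))
    \<longlonglongrightarrow> p / (1 + p)"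
proof (rule tendsto_sandwich[OF _ _ tendsto_const])
  let ?q = "p / (1 + p)"
  have opt: "real (Suc k) \<le> opt (triangle_graph (Suc k))" for k
    by (rule opt_triangle_graph_ge)
  then have opt_pos: "0 < opt (triangle_graph (Suc k))" for k
    by (rule order.strict_trans2[rotated]) simp
  show "\<forall>\<^sub>F k in sequentially.
      ?q \<le> expected_greedy p tie (triangle_graph (Suc k)) / opt (triangle_graph (Suc k))"
    using opt_pos expected_greedy_ge[OF weighted_bipartite_triangle_graph tie p]
    by (intro always_eventually allI) (simp add: pos_le_divide_eq)
  show "\<forall>\<^sub>F k in sequentially.
      expected_greedy p tie (triangle_graph (Suc k)) / opt (triangle_graph (Suc k)) \<le>
      ?q * ((1 + 1 / real (Suc k)) * (1 + 1 / real (Suc k)))"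
  proof (intro always_eventually allI)
    fix k
    let ?n = "real (Suc k)"
    have "expected_greedy p tie (triangle_graph (Suc k)) / opt (triangle_graph (Suc k)) \<le>
        (1 + 1 / ?n) * (?q * (?n + 1)) / ?n"
      using expected_greedy_triangle_graph_le[OF tie p, of "Suc k"] opt[of k] p(1)
      by (intro frac_le) auto
    also have "\<dots> = ?q * ((1 + 1 / ?n) * (1 + 1 / ?n))"
      using p(1) by (simp add: field_simps)
    finally show "expected_greedy p tie (triangle_graph (Suc k)) / opt (triangle_graph (Suc k)) \<le>
        ?q * ((1 + 1 / ?n) * (1 + 1 / ?n))" .
  qed
  have "(\<lambda>k. ?q * ((1 + 1 / real (Suc k)) * (1 + 1 / real (Suc k)))) \<longlonglongrightarrow> ?q * ((1 + 0) * (1 + 0))"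
    by (intro tendsto_intros LIMSEQ_Suc[OF lim_const_over_n])
  then show "(\<lambda>k. ?q * ((1 + 1 / real (Suc k)) * (1 + 1 / real (Suc k)))) \<longlonglongrightarrow> ?q"
    by simp
qed

theorem lemma2p5:
  fixes p :: real
  assumes "0 \<le> p" and "p \<le> 1"
  shows "(\<forall>(G :: ('l, 'r) weighted_bigraph) tie.
            weighted_bipartite G \<longrightarrow> linear_order_on UNIV tie \<longrightarrow>
              expected_greedy p tie G \<ge> p / (1 + p) * opt G) \<and>
         (\<forall>tie :: (nat \<times> nat) rel. linear_order_on UNIV tie \<longrightarrow>
            (\<exists>G :: nat \<Rightarrow> (nat, nat) weighted_bigraph.
               (\<forall>k. weighted_bipartite (G k) \<and> opt (G k) > 0) \<and>
               (\<lambda>k. expected_greedy p tie (G k) / opt (G k)) \<longlonglongrightarrow> p / (1 + p)))"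
proof (intro conjI allI impI)
  fix G :: "('l, 'r) weighted_bigraph" and tie :: "('l \<times> 'r) rel"
  assume "weighted_bipartite G" "linear_order_on UNIV tie"
  then show "expected_greedy p tie G \<ge> p / (1 + p) * opt G"
    using assms by (rule expected_greedy_ge)
next
  fix tie :: "(nat \<times> nat) rel"
  assume tie: "linear_order_on UNIV tie"
  have "0 < opt (triangle_graph (Suc k))" for k
    using opt_triangle_graph_ge[of "Suc k"] by simp
  then show "\<exists>G :: nat \<Rightarrow> (nat, nat) weighted_bigraph.
      (\<forall>k. weighted_bipartite (G k) \<and> opt (G k) > 0) \<and>
      (\<lambda>k. expected_greedy p tie (G k) / opt (G k)) \<longlonglongrightarrow> p / (1 + p)"
    using triangle_graph_ratio_tendsto[OF tie assms] weighted_bipartite_triangle_graph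
    by (intro exI[of _ "\<lambda>k. triangle_graph (Suc k)"]) blast
qed

end
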